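(* Let $r$ be a positive integer, let $a_0,\dots,a_r$ be non-negative real constants, not all zero, let $0<\theta<1$ and $\gamma>0$. Let $N$ be a random variable having the natural discrete one parameter polynomial exponential (NDOPPE) distribution with parameter $\theta$ (and constants $r,a_0,\dots,a_r$), let $X_1,X_2,\dots$ be independent identically distributed exponential random variables with parameter (rate) $\gamma$, i.e. with density $\gamma e^{-\gamma x}$ for $x>0$, and suppose that the sequence $(X_i)_{i\ge 1}$ is independent of $N$. Let $S=\sum_{i=1}^{N}X_i$ (with $S=0$ when $N=0$). Then the pdf $f_S$ of $S$ is given by $$f_S(x)=\gamma(1-\theta)e^{-\gamma x}\,\frac{\sum_{k=0}^{r}a_k\,\Gamma(k+2)\,{}_1F_1\big(k+2;2;\gamma(1-\theta)x\big)}{\sum_{k=0}^{r}a_k\frac{\Gamma(k+1)}{\theta^{k+1}}}\qquad\text{for } x>0,$$ $$f_S(0)=\frac{\sum_{k=0}^{r}a_k\,\Gamma(k+1)}{\sum_{k=0}^{r}a_k\frac{\Gamma(k+1)}{\theta^{k+1}}}\qquad\text{for } x=0.$$ Here $f_S(0)$ is the probability mass $P(S=0)$, and $f_S$ on $(0,\infty)$ is the density of the absolutely continuous part of the law of $S$, that is, $P(S\in B)=\int_B f_S(x)\,dx$ for every Borel set $B\subseteq(0,\infty)$.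
   Context: NDOPPE distribution: given a positive integer $r$, non-negative constants $a_0,\dots,a_r$ (not all zero) and $0<\theta<1$, a random variable $N$ has the NDOPPE distribution with parameter $\theta$ if it takes values in $\{0,1,2,\dots\}$ with probability mass function $$P(N=n)=\frac{\sum_{k=0}^{r}a_k\frac{\Gamma(k+1)}{\theta^{k+1}}\binom{n+k}{n}(1-\theta)^n\theta^{k+1}}{\sum_{k=0}^{r}a_k\frac{\Gamma(k+1)}{\theta^{k+1}}},\qquad n=0,1,2,\dots$$ The function ${}_1F_1$ is the confluent hypergeometric function ${}_1F_1(a;b;z)=\sum_{m=0}^{\infty}\frac{(a)_m}{(b)_m}\frac{z^m}{m!}$, where $(a)_m=a(a+1)\cdots(a+m-1)$ and $(a)_0=1$. *)

theory Defs
  imports "HOL-Probability.Probability"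
begin

text \<open>
  Meaningful only when \<open>b\<close> is not a non-positive integer; otherwise the series
  contains divisions by zero, which HOL evaluates to zero.
\<close>
definition hyp1F1 :: "real \<Rightarrow> real \<Rightarrow> real \<Rightarrow> real" where
  "hyp1F1 a b z = (\<Sum>m. pochhammer a m / pochhammer b m * (z ^ m / fact m))"

lemma hyp1F1_eq_eval_fps: "hyp1F1 a b z = eval_fps (fps_hypergeo [a] [b] 1) z"
  by (simp add: hyp1F1_def eval_fps_def)

text \<open>
  The library's \<open>indep_var\<close> requires both variables to have the same value type.
  This drops that restriction; the right-hand side is the one of \<open>indep_var_eq\<close>.
\<close>
definition indep_rv ::
  "'a measure \<Rightarrow> 'b measure \<Rightarrow> ('a \<Rightarrow> 'b) \<Rightarrow> 'c measure \<Rightarrow> ('a \<Rightarrow> 'c) \<Rightarrow> bool" where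
  "indep_rv M S X T Y \<longleftrightarrow>
     X \<in> measurable M S \<and> Y \<in> measurable M T \<and>
     prob_space.indep_set M
       (sigma_sets (space M) {X -` A \<inter> space M | A. A \<in> sets S})
       (sigma_sets (space M) {Y -` A \<inter> space M | A. A \<in> sets T})"

lemma (in prob_space) indep_rv_eq_indep_var: "indep_rv M S X T Y \<longleftrightarrow> indep_var S X T Y"
  by (simp add: indep_rv_def indep_var_eq)

definition ndoppe_pmf :: "nat \<Rightarrow> (nat \<Rightarrow> real) \<Rightarrow> real \<Rightarrow> nat \<Rightarrow> real" where
  "ndoppe_pmf r a \<theta> n =
     (\<Sum>k=0..r. a k * (Gamma (real k + 1) / \<theta> ^ (k + 1)) *
        real ((n + k) choose n) * (1 - \<theta>) ^ n * \<theta> ^ (k + 1)) /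
     (\<Sum>k=0..r. a k * (Gamma (real k + 1) / \<theta> ^ (k + 1)))"

text \<open>
  The density of a random variable on \<open>[0, \<infinity>)\<close> whose law is a point mass at \<open>0\<close> plus an
  absolutely continuous part: \<open>f 0\<close> is the mass of the atom, and \<open>f\<close> on \<open>(0, \<infinity>)\<close> is the
  Lebesgue density of the rest. Integrability is required explicitly because the Lebesgue
  integral of a non-integrable function is \<open>0\<close> in HOL.
\<close>
definition has_pdf_with_atom_at_0 :: "'a measure \<Rightarrow> ('a \<Rightarrow> real) \<Rightarrow> (real \<Rightarrow> real) \<Rightarrow> bool" where
  "has_pdf_with_atom_at_0 M S f \<longleftrightarrow>
     S \<in> borel_measurable M \<and>
     measure M {\<omega> \<in> space M. S \<omega> = 0} = f 0 \<and>
     (\<forall>B \<in> sets borel. B \<subseteq> {0<..} \<longrightarrow>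
        set_integrable lborel B f \<and>
        measure M {\<omega> \<in> space M. S \<omega> \<in> B} = (LINT x:B|lborel. f x))"

end

(*
  Conditioning on N splits the law of S into the atom P(N = 0) at 0 and a mixture, with weights
  P(N = m + 1), of the Erlang laws of X_1 + ... + X_(m+1). Its density is summed termwise: since
  k! * binomial(m+1+k, m+1) / m! = (k+1)! * (k+2)_m / ((2)_m * m!), the k-th summand of the
  NDOPPE weights contributes the series of 1F1(k+2; 2; .). Everything is non-negative, so
  monotone convergence justifies the exchange of sum and integral.
*)
theory Submission
  imports Defs "HOL-Real_Asymp.Real_Asymp"
begin

section \<open>Convergence and termwise summation of the mixture density\<close>

lemma summable_hyp1F1:
  fixes a b z :: real
  assumes "b > 0"
  shows "summable (\<lambda>m. pochhammer a m / pochhammer b m * (z ^ m / fact m))"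
proof -
  \<comment> \<open>The product is the absolute ratio of consecutive terms. It tends to 0, so
    \<open>1 / 2\<close> serves as a constant for the ratio test.\<close>
  have "(\<lambda>m. \<bar>(a + real m) / (b + real m)\<bar> * \<bar>z / (real m + 1)\<bar>) \<longlonglongrightarrow> \<bar>1\<bar> * \<bar>0\<bar>"
    by (intro tendsto_intros) real_asymp+
  then have "eventually (\<lambda>m. \<bar>(a + real m) / (b + real m)\<bar> * \<bar>z / (real m + 1)\<bar> < 1 / 2) sequentially"
    by (rule order_tendstoD) simp
  then obtain K where K: "\<And>m. m \<ge> K \<Longrightarrow> \<bar>(a + real m) / (b + real m)\<bar> * \<bar>z / (real m + 1)\<bar> < 1 / 2"
    by (auto simp: eventually_sequentially)
  show ?thesis
  proof (rule summable_ratio_test[where c = "1 / 2" and N = K])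
    fix m assume "m \<ge> K"
    let ?c = "\<lambda>m. pochhammer a m / pochhammer b m * (z ^ m / fact m)"
    have "?c (Suc m) = (a + real m) / (b + real m) * (z / (real m + 1)) * ?c m"
      by (simp add: pochhammer_Suc mult_ac add_ac)
    then have "norm (?c (Suc m)) = \<bar>(a + real m) / (b + real m)\<bar> * \<bar>z / (real m + 1)\<bar> * norm (?c m)"
      by (simp only: abs_mult real_norm_def)
    also have "\<dots> \<le> 1 / 2 * norm (?c m)"
      using K[OF \<open>m \<ge> K\<close>] by (intro mult_right_mono) auto
    finally show "norm (?c (Suc m)) \<le> 1 / 2 * norm (?c m)" .
  qed simp
qed

text \<open>Both sides equal \<open>(m+1+k)! / ((m+1)! m!)\<close>: on the left the
  \<open>k!\<close> cancels against the binomial, on the right \<open>(k+1)!\<close> completes the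
  rising factorial to \<open>(m+1+k)!\<close>.\<close>

lemma Gamma_mult_choose:
  "Gamma (real k + 1) * real ((Suc m + k) choose (Suc m)) / fact m =
     Gamma (real k + 2) * (pochhammer (real k + 2) m / pochhammer 2 m / fact m)"
proof -
  have g1: "Gamma (real k + 1) = fact k"
    using Gamma_fact[of k, where 'a = real] by (simp add: add_ac)
  have g2: "Gamma (real k + 2) = fact (Suc k)"
    using Gamma_fact[of "Suc k", where 'a = real] by (simp add: add_ac)
  \<comment> \<open>Used twice: \<open>j = 0\<close> turns \<open>pochhammer 2 m\<close> into
    \<open>(m+1)!\<close>, and \<open>j = k\<close> handles the numerator.\<close>
  have p: "fact (Suc j) * pochhammer (real j + 2) m = (fact (Suc j + m) :: real)" for j
    by (induction m) (simp_all add: pochhammer_Suc algebra_simps)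
  have "pochhammer 2 m = (fact (Suc m) :: real)"
    using p[of 0] by simp
  moreover have "real ((Suc m + k) choose (Suc m)) = fact (Suc m + k) / (fact (Suc m) * fact k)"
    by (subst binomial_fact) auto
  moreover have "fact (Suc k) * pochhammer (real k + 2) m = (fact (Suc m + k) :: real)"
    using p[of k] by (simp add: add_ac)
  ultimately show ?thesis
    unfolding g1 g2 by (simp del: fact_Suc)
qed

text \<open>In each numerator term the two powers of \<theta> cancel, so only the normalising
  constant keeps them.\<close>

lemma ndoppe_pmf_cancel:
  assumes "\<theta> \<noteq> 0"
  shows "ndoppe_pmf r a \<theta> n =
     (\<Sum>k=0..r. a k * (Gamma (real k + 1) * real ((n + k) choose n)) * (1 - \<theta>) ^ n) /
     (\<Sum>k=0..r. a k * (Gamma (real k + 1) / \<theta> ^ (k + 1)))"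
  unfolding ndoppe_pmf_def
  by (intro arg_cong2[where f = "(/)"] sum.cong refl) (use assms in \<open>simp add: field_simps\<close>)

text \<open>The index \<open>m\<close> belongs to \<open>m + 1\<close> summands, hence the weight at
  \<open>Suc m\<close>. Using \<open>sums\<close> records convergence together with the value; both
  are used when passing to extended non-negative reals.\<close>

lemma ndoppe_erlang_mixture_sums:
  assumes "\<theta> \<noteq> 0" "x > 0"
  shows "(\<lambda>m. ndoppe_pmf r a \<theta> (Suc m) * erlang_density m \<gamma> x) sums
     (\<gamma> * (1 - \<theta>) * exp (- \<gamma> * x) *
        ((\<Sum>k=0..r. a k * Gamma (real k + 2) * hyp1F1 (real k + 2) 2 (\<gamma> * (1 - \<theta>) * x)) /
         (\<Sum>k=0..r. a k * (Gamma (real k + 1) / \<theta> ^ (k + 1)))))"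
proof -
  define D where "D = (\<Sum>k=0..r. a k * (Gamma (real k + 1) / \<theta> ^ (k + 1)))"
  define z where "z = \<gamma> * (1 - \<theta>) * x"
  define c where "c k m = pochhammer (real k + 2) m / pochhammer 2 m * (z ^ m / fact m)" for k m
  have c: "c k sums hyp1F1 (real k + 2) 2 z" for k
    unfolding c_def hyp1F1_def by (intro summable_sums summable_hyp1F1) simp
  have term_eq: "ndoppe_pmf r a \<theta> (Suc m) * erlang_density m \<gamma> x =
    \<gamma> * (1 - \<theta>) * exp (- \<gamma> * x) * ((\<Sum>k=0..r. a k * Gamma (real k + 2) * c k m) / D)" for m
  proof -
    have "a k * (Gamma (real k + 1) * real ((Suc m + k) choose (Suc m))) * (1 - \<theta>) ^ Suc m *
        erlang_density m \<gamma> x =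
      \<gamma> * (1 - \<theta>) * exp (- \<gamma> * x) * (a k * Gamma (real k + 2) * c k m)" for k
    proof -
      \<comment> \<open>For positive \<open>x\<close> the Erlang density is \<gamma>^(m+1) x^m
        exp(-\<gamma> x) / m!. Combined with (1-\<theta>)^(m+1), one factor \<gamma>(1-\<theta>)
        splits off and the remaining powers form \<open>z ^ m\<close>.\<close>
      have "a k * (Gamma (real k + 1) * real ((Suc m + k) choose (Suc m))) * (1 - \<theta>) ^ Suc m *
          erlang_density m \<gamma> x =
        a k * (\<gamma> * (1 - \<theta>)) * exp (- \<gamma> * x) * z ^ m *
          (Gamma (real k + 1) * real ((Suc m + k) choose (Suc m)) / fact m)"
        using assms(2)
        by (simp add: erlang_density_def z_def power_mult_distrib mult_ac del: binomial_Suc_Suc)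
      also have "\<dots> = \<gamma> * (1 - \<theta>) * exp (- \<gamma> * x) * (a k * Gamma (real k + 2) * c k m)"
        unfolding Gamma_mult_choose c_def by (simp add: mult_ac)
      finally show ?thesis .
    qed
    then show ?thesis
      unfolding ndoppe_pmf_cancel[OF assms(1)] D_def[symmetric]
      by (simp only: times_divide_eq_left times_divide_eq_right sum_distrib_left sum_distrib_right)
  qed
  show ?thesis
    unfolding term_eq D_def[symmetric] z_def[symmetric]
    by (intro sums_mult sums_divide sums_sum c)
qed

section \<open>Conditioning on an independent random index\<close>

context prob_space
begin

lemma measurable_randomly_indexed:
  fixes N :: "'a \<Rightarrow> nat"
  assumes "N \<in> measurable M (count_space UNIV)" "\<And>n. T n \<in> measurable M L"
  shows "(\<lambda>\<omega>. T (N \<omega>) \<omega>) \<in> measurable M L"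
  using assms(2,1) by (rule measurable_compose_countable)

text \<open>Total probability over the values of \<open>N\<close>: on \<open>N = n\<close> the index
  is frozen, and \<open>g n (Y)\<close> is a function of \<open>Y\<close> alone, so the event
  factors. Here \<open>Y\<close> may be a whole sequence and \<open>g n\<close> a function of its
  first terms.\<close>

lemma emeasure_randomly_indexed:
  fixes N :: "'a \<Rightarrow> nat"
  assumes indep: "indep_rv M (count_space UNIV) N L Y"
    and g: "\<And>n. g n \<in> measurable L K"
    and B: "B \<in> sets K"
  shows "emeasure M {\<omega> \<in> space M. g (N \<omega>) (Y \<omega>) \<in> B} =
    (\<Sum>n. emeasure M {\<omega> \<in> space M. N \<omega> = n} * emeasure M {\<omega> \<in> space M. g n (Y \<omega>) \<in> B})"
proof -
  from indep have N[measurable]: "N \<in> measurable M (count_space UNIV)"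
    and Y[measurable]: "Y \<in> measurable M L"
    and ind: "indep_set
       (sigma_sets (space M) {N -` A \<inter> space M | A. A \<in> sets (count_space UNIV)})
       (sigma_sets (space M) {Y -` A \<inter> space M | A. A \<in> sets L})"
    by (simp_all add: indep_rv_def)
  note g[measurable] B[measurable]
  define E where "E n = {\<omega> \<in> space M. N \<omega> = n} \<inter> {\<omega> \<in> space M. g n (Y \<omega>) \<in> B}" for n
  have "{\<omega> \<in> space M. g (N \<omega>) (Y \<omega>) \<in> B} = (\<Union>n. E n)"
    by (auto simp: E_def)
  moreover have "emeasure M (\<Union>n. E n) = (\<Sum>n. emeasure M (E n))"
    by (intro suminf_emeasure[symmetric]) (auto simp: E_def disjoint_family_on_def)
  moreover have "emeasure M (E n) =
    emeasure M {\<omega> \<in> space M. N \<omega> = n} * emeasure M {\<omega> \<in> space M. g n (Y \<omega>) \<in> B}" for n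
  proof -
    have N_eq: "{\<omega> \<in> space M. N \<omega> = n} = N -` {n} \<inter> space M"
      by auto
    \<comment> \<open>Pulling \<open>B\<close> back through \<open>g n\<close> first exhibits the
      event as a preimage under \<open>Y\<close>, so it lies in the second of the two independent
      families.\<close>
    have Y_eq: "{\<omega> \<in> space M. g n (Y \<omega>) \<in> B} = Y -` (g n -` B \<inter> space L) \<inter> space M"
      using measurable_space[OF Y] by auto
    have "g n -` B \<inter> space L \<in> sets L"
      by measurable
    then have "{\<omega> \<in> space M. g n (Y \<omega>) \<in> B} \<in> {Y -` A \<inter> space M | A. A \<in> sets L}"
      unfolding Y_eq by blast
    moreover have "{\<omega> \<in> space M. N \<omega> = n} \<in> {N -` A \<inter> space M | A. A \<in> sets (count_space UNIV)}"
      unfolding N_eq by auto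
    ultimately have "prob (E n) =
      prob {\<omega> \<in> space M. N \<omega> = n} * prob {\<omega> \<in> space M. g n (Y \<omega>) \<in> B}"
      unfolding E_def by (intro indep_setD[OF ind] sigma_sets.Basic)
    then show ?thesis
      by (simp add: emeasure_eq_measure ennreal_mult)
  qed
  ultimately show ?thesis by simp
qed

lemma distributed_count_space_emeasure:
  assumes "distributed M (count_space UNIV) N p"
  shows "emeasure M {\<omega> \<in> space M. N \<omega> = n} = p n"
proof -
  have "emeasure M {\<omega> \<in> space M. N \<omega> = n} = emeasure M (N -` {n} \<inter> space M)"
    by (intro arg_cong[where f = "emeasure M"]) auto
  also have "\<dots> = p n"
    by (subst distributed_emeasure[OF assms])
       (auto simp: nn_integral_count_space_indicator[symmetric] one_ennreal_def[symmetric])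
  finally show ?thesis .
qed

end

section \<open>The law of the compound sum: atom and density\<close>

theorem theorem7p1:
  fixes M :: "'a measure" and N :: "'a \<Rightarrow> nat" and X :: "nat \<Rightarrow> 'a \<Rightarrow> real"
    and r :: nat and a :: "nat \<Rightarrow> real" and \<theta> \<gamma> :: real
  assumes "prob_space M"
    and "r \<ge> 1"
    and "\<And>k. k \<le> r \<Longrightarrow> a k \<ge> 0"
    and "\<exists>k\<le>r. a k \<noteq> 0"
    and "0 < \<theta>" and "\<theta> < 1"
    and "\<gamma> > 0"
    and "distributed M (count_space UNIV) N (\<lambda>n. ennreal (ndoppe_pmf r a \<theta> n))"
    and "\<And>i. i \<ge> 1 \<Longrightarrow> distributed M lborel (X i) (\<lambda>x. ennreal (exponential_density \<gamma> x))"
    and "prob_space.indep_vars M (\<lambda>_. borel) X {1..}"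
    and "indep_rv M (count_space UNIV) N
           (Pi\<^sub>M {1..} (\<lambda>_. borel :: real measure)) (\<lambda>\<omega>. \<lambda>i\<in>{1..}. X i \<omega>)"
  shows "has_pdf_with_atom_at_0 M (\<lambda>\<omega>. \<Sum>i=1..N \<omega>. X i \<omega>)
    (\<lambda>x. if x = 0 then
            (\<Sum>k=0..r. a k * Gamma (real k + 1)) /
            (\<Sum>k=0..r. a k * (Gamma (real k + 1) / \<theta> ^ (k + 1)))
          else if x > 0 then
            \<gamma> * (1 - \<theta>) * exp (- \<gamma> * x) *
            ((\<Sum>k=0..r. a k * Gamma (real k + 2) * hyp1F1 (real k + 2) 2 (\<gamma> * (1 - \<theta>) * x)) /
             (\<Sum>k=0..r. a k * (Gamma (real k + 1) / \<theta> ^ (k + 1))))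
          else 0)"
proof -
  interpret prob_space M by fact
  \<comment> \<open>\<open>Y\<close> bundles the sequence into one variable and \<open>T n\<close>
    is its \<open>n\<close>-th partial sum, so the compound sum takes the form
    \<open>T (N \<omega>) (Y \<omega>)\<close>.\<close>
  define Y where "Y = (\<lambda>\<omega>. \<lambda>i\<in>{1..}. X i \<omega>)"
  define T :: "nat \<Rightarrow> (nat \<Rightarrow> real) \<Rightarrow> real" where "T n y = (\<Sum>i=1..n. y i)" for n y
  define D where "D = (\<Sum>k=0..r. a k * (Gamma (real k + 1) / \<theta> ^ (k + 1)))"
  let ?p = "ndoppe_pmf r a \<theta>"
  let ?S = "\<lambda>\<omega>. \<Sum>i=1..N \<omega>. X i \<omega>"
  define f where "f x = \<gamma> * (1 - \<theta>) * exp (- \<gamma> * x) *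
            ((\<Sum>k=0..r. a k * Gamma (real k + 2) * hyp1F1 (real k + 2) 2 (\<gamma> * (1 - \<theta>) * x)) / D)" for x
  have D: "D \<ge> 0"
    unfolding D_def using assms by (intro sum_nonneg mult_nonneg_nonneg divide_nonneg_nonneg) auto
  have p: "?p n \<ge> 0" for n
    unfolding ndoppe_pmf_def D_def[symmetric] using assms D
    by (intro sum_nonneg mult_nonneg_nonneg divide_nonneg_nonneg) auto
  have N[measurable]: "N \<in> measurable M (count_space UNIV)"
    using assms(11) by (simp add: indep_rv_def)
  have Y[measurable]: "Y \<in> measurable M (Pi\<^sub>M {1..} (\<lambda>_. borel))"
    using assms(11) by (simp add: indep_rv_def Y_def)
  have T[measurable]: "T n \<in> measurable (Pi\<^sub>M {1..} (\<lambda>_. borel)) borel" for n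
    unfolding T_def by (intro borel_measurable_sum measurable_component_singleton) auto
  have TY: "T n (Y \<omega>) = (\<Sum>i=1..n. X i \<omega>)" for n \<omega>
    by (simp add: T_def Y_def)
  have S[measurable]: "?S \<in> borel_measurable M"
    unfolding TY[symmetric] by (rule measurable_randomly_indexed) measurable
  \<comment> \<open>The parameter of \<open>erlang_density\<close> is the number of summands minus
    one.\<close>
  have erlang: "distributed M lborel (\<lambda>\<omega>. T (Suc m) (Y \<omega>)) (erlang_density m \<gamma>)" for m
    unfolding TY
    using exponential_distributed_sum[of "{1..Suc m}" \<gamma> X]
      assms(7,9) indep_vars_subset[OF assms(10), of "{1..Suc m}"] by auto
  \<comment> \<open>The empty sum is the constant 0 and has no density, so the term for
    \<open>n = 0\<close> is split off as a point mass. Since \<open>B\<close> is an arbitrary Borel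
    set, this formula yields both the atom and the continuous part.\<close>
  have mix: "emeasure M {\<omega> \<in> space M. ?S \<omega> \<in> B} = ennreal (?p 0) * indicator B 0 +
      (\<Sum>m. ennreal (?p (Suc m)) * (\<integral>\<^sup>+x. ennreal (erlang_density m \<gamma> x) * indicator B x \<partial>lborel))"
    if B[measurable]: "B \<in> sets borel" for B
  proof -
    let ?e = "\<lambda>n. ennreal (?p n) * emeasure M {\<omega> \<in> space M. T n (Y \<omega>) \<in> B}"
    have shift: "?e (m + 1) = ennreal (?p (Suc m)) *
        (\<integral>\<^sup>+x. ennreal (erlang_density m \<gamma> x) * indicator B x \<partial>lborel)" for m
    proof -
      have *: "{\<omega> \<in> space M. T (Suc m) (Y \<omega>) \<in> B} = (\<lambda>\<omega>. T (Suc m) (Y \<omega>)) -` B \<inter> space M" by auto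
      show ?thesis
        unfolding Suc_eq_plus1[symmetric] * by (subst distributed_emeasure[OF erlang]) simp_all
    qed
    have "emeasure M {\<omega> \<in> space M. ?S \<omega> \<in> B} = (\<Sum>n. ?e n)"
      unfolding TY[symmetric]
      using emeasure_randomly_indexed[OF assms(11)[folded Y_def] T B]
      by (simp add: distributed_count_space_emeasure[OF assms(8)])
    also have "\<dots> = (\<Sum>n. ?e (n + 1)) + (\<Sum>n<1. ?e n)"
      by (rule suminf_offset) simp
    also have "(\<Sum>n<1. ?e n) = ennreal (?p 0) * indicator B 0"
      by (auto simp: T_def emeasure_space_1 indicator_def)
    finally show ?thesis
      unfolding shift by (subst add.commute)
  qed
  have atom: "measure M {\<omega> \<in> space M. ?S \<omega> = 0} = ?p 0"
  proof -
    \<comment> \<open>The Erlang components do not charge the Lebesgue null set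
      \<open>{0}\<close>.\<close>
    have "(\<integral>\<^sup>+x. ennreal (erlang_density m \<gamma> x) * indicator {0} x \<partial>lborel) = 0" for m
      using AE_lborel_singleton[of "0 :: real"]
      by (intro nn_integral_zero') (auto simp: indicator_def elim: eventually_mono)
    then have "emeasure M {\<omega> \<in> space M. ?S \<omega> = 0} = ennreal (?p 0)"
      using mix[of "{0}"] by simp
    then show ?thesis using p by (simp add: measure_def)
  qed
  \<comment> \<open>At \<open>n = 0\<close> the binomials and the power of 1-\<theta> are all
    1.\<close>
  have p0: "?p 0 = (\<Sum>k=0..r. a k * Gamma (real k + 1)) / D"
    using assms(5) by (simp add: ndoppe_pmf_cancel D_def)
  \<comment> \<open>Stated for any \<open>h\<close> that agrees with \<open>f\<close> on the
    positive half-line, so that it applies to the function defined by cases in the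
    conclusion.\<close>
  have ac: "set_integrable lborel B h \<and>
        measure M {\<omega> \<in> space M. ?S \<omega> \<in> B} = (LINT x:B|lborel. h x)"
    if B[measurable]: "B \<in> sets borel" and pos: "B \<subseteq> {0<..}" and h: "\<And>x. x > 0 \<Longrightarrow> h x = f x" for B h
  proof -
    have "0 \<notin> B"
      using pos by auto
    have sums: "(\<lambda>m. ?p (Suc m) * erlang_density m \<gamma> x) sums f x" if "x > 0" for x
      unfolding f_def D_def using that assms(5) by (intro ndoppe_erlang_mixture_sums) auto
    have f_eq: "f x = (\<Sum>m. ?p (Suc m) * erlang_density m \<gamma> x)" if "x > 0" for x
      using sums[OF that] by (rule sums_unique)
    have f_nonneg: "f x \<ge> 0" if "x > 0" for x
      unfolding f_eq[OF that] using sums[OF that] p assms(7)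
      by (intro suminf_nonneg mult_nonneg_nonneg erlang_density_nonneg) (auto simp: sums_iff)
    \<comment> \<open>Measurability comes from the series of measurable Erlang densities. The
      indicator hides the values of \<open>h\<close> outside the positive half-line, about which
      nothing is known.\<close>
    have meas: "(\<lambda>x. indicator B x * h x) \<in> borel_measurable lborel"
    proof -
      have "(\<lambda>x. indicator B x * h x) =
        (\<lambda>x. indicator B x * (\<Sum>m. ?p (Suc m) * erlang_density m \<gamma> x))"
        using pos h f_eq by (auto simp: indicator_def fun_eq_iff)
      then show ?thesis by simp
    qed
    have "emeasure M {\<omega> \<in> space M. ?S \<omega> \<in> B} =
      (\<Sum>m. \<integral>\<^sup>+x. ennreal (?p (Suc m)) * (ennreal (erlang_density m \<gamma> x) * indicator B x) \<partial>lborel)"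
      using \<open>0 \<notin> B\<close> by (subst mix[OF B]) (simp add: nn_integral_cmult)
    also have "\<dots> = (\<integral>\<^sup>+x. (\<Sum>m. ennreal (?p (Suc m)) *
        (ennreal (erlang_density m \<gamma> x) * indicator B x)) \<partial>lborel)"
      by (rule nn_integral_suminf[symmetric]) simp
    also have "\<dots> = (\<integral>\<^sup>+x. ennreal (indicator B x * h x) \<partial>lborel)"
    proof (rule nn_integral_cong)
      fix x :: real
      show "(\<Sum>m. ennreal (?p (Suc m)) * (ennreal (erlang_density m \<gamma> x) * indicator B x)) =
        ennreal (indicator B x * h x)"
      proof (cases "x \<in> B")
        case True
        then have "x > 0" using pos by auto
        have "(\<Sum>m. ennreal (?p (Suc m) * erlang_density m \<gamma> x)) = ennreal (f x)"
          using sums[OF \<open>x > 0\<close>] p assms(7) by (intro suminf_ennreal_eq) auto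
        then show ?thesis
          using True p assms(7) h[OF \<open>x > 0\<close>] by (simp add: ennreal_mult)
      qed simp
    qed
    finally have eq: "(\<integral>\<^sup>+x. ennreal (indicator B x * h x) \<partial>lborel) =
      ennreal (measure M {\<omega> \<in> space M. ?S \<omega> \<in> B})"
      by (simp add: emeasure_eq_measure)
    \<comment> \<open>The non-negative integral equals a probability and is therefore finite, which
      gives integrability and the value of the integral at once.\<close>
    have "has_bochner_integral lborel (\<lambda>x. indicator B x * h x) (measure M {\<omega> \<in> space M. ?S \<omega> \<in> B})"
    proof (rule has_bochner_integral_nn_integral)
      show "AE x in lborel. 0 \<le> indicator B x * h x"
        using pos h f_nonneg by (intro AE_I2) (auto simp: indicator_def)
    qed (use meas eq in auto)
    then show ?thesis
      by (simp add: set_integrable_def set_lebesgue_integral_def has_bochner_integral_iff)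
  qed
  show ?thesis
    unfolding has_pdf_with_atom_at_0_def D_def[symmetric] f_def[symmetric]
    by (intro conjI[OF S] conjI ballI impI ac[THEN conjunct1] ac[THEN conjunct2])
       (simp_all add: atom p0 del: One_nat_def)
qed

end
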